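(* Let $F$ be a field. Consider the following three properties: (a) $F$ is rootless modtor; (b) every linear polynomial in $F[x]$ whose zero is neither $0$ nor a root of unity has good heredity over $F$; (c) $F$ is rootless. Then: (1) (a) implies (b), and (b) implies (c). (2) If $F$ contains all roots of unity (i.e. all roots of unity of its algebraic closure), or if $F$ contains only finitely many roots of unity, then (a), (b), (c) are equivalent. (3) If all finite extensions of $F$ are rootless modtor, then $F$ has good heredity.
   Context: Let $F$ be a field with algebraic closure $F^{alg}$. A polynomial $P \in F[x]$ is hereditarily irreducible over $F$ if for every integer $n\ge 1$ the polynomial $P(x^n)$ is irreducible over $F$. A polynomial $P\in F[x]$ has good heredity (over $F$) if for some integer $n \geq 1$ the polynomial $P(x^n)$ factors (up to a nonzero constant) as a product of polynomials in $F[x]$ that are hereditarily irreducible over $F$. The field $F$ has good heredity if every polynomial $P \in F[x]$, none of whose roots in $F^{alg}$ is zero or a root of unity, has good heredity over $F$. An element $a \in F$ that is not a root of unity is rootless (in $F$) if for all but finitely many integers $n\ge 1$ the equation $x^n = a$ has no solution in $F$. An element $a\in F$ that is not a root of unity is rootless modtor (in $F$) if for all but finitely many integers $n\ge 1$, for every root of unity $\zeta \in F$ the equation $x^n=\zeta a$ has no solution in $F$. The field $F$ is rootless (resp. rootless modtor) if every nonzero $f \in F$ that is not a root of unity is rootless (resp. rootless modtor) in $F$. *)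

theory Defs
  imports "HOL-Algebra.Algebraic_Closure_Type"
begin

text \<open>
  The base field is a type \<open>'a :: field\<close>, with algebraic closure
  \<open>'a alg_closure\<close> and embedding \<^const>\<open>to_ac\<close>. HOL-Algebra reuses several names of
  the type-class libraries, so the latter are qualified below.
\<close>

definition root_of_unity :: "'a::field \<Rightarrow> bool" where
  "root_of_unity z \<longleftrightarrow> (\<exists>n\<ge>1. z ^ n = 1)"


subsection \<open>Rootless fields\<close>

text \<open>
  The notions are relative to a subfield \<open>K\<close> of a type, so that they apply both to the
  base field (\<open>K = UNIV\<close>) and to its extensions inside the algebraic closure.
\<close>

definition rootless_in :: "'b::field set \<Rightarrow> 'b \<Rightarrow> bool" where
  "rootless_in K a \<longleftrightarrow> a \<in> K \<and> \<not> root_of_unity a \<and>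
     finite {n::nat. n \<ge> 1 \<and> (\<exists>x\<in>K. x ^ n = a)}"

definition rootless_modtor_in :: "'b::field set \<Rightarrow> 'b \<Rightarrow> bool" where
  "rootless_modtor_in K a \<longleftrightarrow> a \<in> K \<and> \<not> root_of_unity a \<and>
     finite {n::nat. n \<ge> 1 \<and> (\<exists>\<zeta>\<in>K. root_of_unity \<zeta> \<and> (\<exists>x\<in>K. x ^ n = \<zeta> * a))}"

definition rootless_field :: "'b::field set \<Rightarrow> bool" where
  "rootless_field K \<longleftrightarrow> (\<forall>f\<in>K. f \<noteq> 0 \<and> \<not> root_of_unity f \<longrightarrow> rootless_in K f)"

definition rootless_modtor_field :: "'b::field set \<Rightarrow> bool" where
  "rootless_modtor_field K \<longleftrightarrow> (\<forall>f\<in>K. f \<noteq> 0 \<and> \<not> root_of_unity f \<longrightarrow> rootless_modtor_in K f)"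

text \<open>
  Every finite extension of the base field is isomorphic over it to one inside the
  algebraic closure, and being rootless modtor is invariant under isomorphism.
\<close>

definition finite_extension :: "'a::field alg_closure set \<Rightarrow> bool" where
  "finite_extension K \<longleftrightarrow>
     subfield K ring_of_type_algebra \<and> range to_ac \<subseteq> K \<and>
     ring.finite_dimension ring_of_type_algebra (range to_ac) K"


subsection \<open>Heredity\<close>

definition subst_power :: "'a::field Polynomial.poly \<Rightarrow> nat \<Rightarrow> 'a Polynomial.poly" where
  "subst_power P n = Polynomial.pcompose P (Polynomial.monom 1 n)"

definition hereditarily_irreducible :: "'a::field Polynomial.poly \<Rightarrow> bool" where
  "hereditarily_irreducible P \<longleftrightarrow> (\<forall>n\<ge>1. Factorial_Ring.irreducible (subst_power P n))"

definition poly_good_heredity :: "'a::field Polynomial.poly \<Rightarrow> bool" where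
  "poly_good_heredity P \<longleftrightarrow>
     (\<exists>n\<ge>1. \<exists>c Qs. c \<noteq> 0 \<and> (\<forall>Q\<in>#Qs. hereditarily_irreducible Q) \<and>
        subst_power P n = Polynomial.smult c (prod_mset Qs))"

definition field_good_heredity :: "'a::field itself \<Rightarrow> bool" where
  "field_good_heredity _ \<longleftrightarrow>
     (\<forall>P :: 'a Polynomial.poly.
        (\<forall>z :: 'a alg_closure. Polynomial.poly (map_poly to_ac P) z = 0 \<longrightarrow>
           z \<noteq> 0 \<and> \<not> root_of_unity z) \<longrightarrow>
        poly_good_heredity P)"

definition linear_good_heredity :: "'a::field itself \<Rightarrow> bool" where
  "linear_good_heredity _ \<longleftrightarrow>
     (\<forall>P :: 'a Polynomial.poly.
        Polynomial.degree P = 1 \<and>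
        (\<forall>z. Polynomial.poly P z = 0 \<longrightarrow> z \<noteq> 0 \<and> \<not> root_of_unity z) \<longrightarrow>
        poly_good_heredity P)"

end

theory Submission
  imports Defs
begin

text \<open>
  Good heredity of \<open>P\<close> is controlled by the number of factors of \<open>P(x\<^sup>n)\<close>.

  If \<open>P(x\<^sup>n)\<close> is written as a product of nonconstant factors and \<open>n\<close> is replaced by a
  multiple \<open>nm\<close>, substituting \<open>x\<^sup>m\<close> in the factors gives a product for \<open>P(x\<^sup>n\<^sup>m)\<close> with as many
  factors. So if the number of nonconstant factors stays bounded over all \<open>n\<close>, a product with the
  greatest number of factors consists of hereditarily irreducible ones. As \<open>P(x\<^sup>n)\<close> has degree \<open>n deg P\<close>,
  the number is bounded as soon as every nonconstant factor of \<open>P(x\<^sup>n)\<close> has degree at least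
  \<open>n / M\<close> for a constant \<open>M\<close> (\<open>good_heredity_if_factor_degrees_large\<close>).

  Such an \<open>M\<close> comes from a norm computation. A nonconstant factor has a root \<open>\<beta>\<close> in the algebraic
  closure, and \<open>\<alpha> = \<beta>\<^sup>n\<close> is a root of \<open>P\<close>. Let \<open>K\<close> be a field containing \<open>\<alpha>\<close> and the base field. All
  conjugates of \<open>\<beta>\<close> over \<open>K\<close> are \<open>n\<close>-th roots of \<open>\<alpha>\<close>, so if there are \<open>d\<close> of them (with
  multiplicity) their product \<open>g \<in> K\<close> satisfies \<open>g\<^sup>n = \<alpha>\<^sup>d\<close>. By Bezout, \<open>\<alpha>\<close> times a root of unity of
  \<open>K\<close> is then a power in \<open>K\<close> with exponent \<open>n / gcd d n\<close>
  (\<open>power_modulo_torsion_if_power_eq\<close>). If \<open>\<alpha>\<close> is rootless modtor in \<open>K\<close>, these exponents are at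
  most some \<open>M\<close>, whence \<open>d \<ge> gcd d n \<ge> n / M\<close>. For linear \<open>P\<close> the base field serves as \<open>K\<close>;
  in general \<open>K\<close> is the finite extension generated by \<open>\<alpha>\<close>, and \<open>M\<close> is taken over the finitely many
  roots of \<open>P\<close>.

  Conversely, let \<open>x - f\<close> have good heredity, so that \<open>x\<^sup>n - f\<close> is a product of hereditarily
  irreducible \<open>Q\<^sub>j\<close>. If \<open>f = b\<^sup>N\<close>, then \<open>x\<^sup>n - b\<close> divides \<open>x\<^sup>n\<^sup>N - f\<close>, whose irreducible factors
  \<open>Q\<^sub>j(x\<^sup>N)\<close> have degree at least \<open>N\<close>; hence \<open>N \<le> n\<close> and \<open>f\<close> is rootless.

  Finally, rootless and rootless modtor differ only by the torsion factor \<open>\<zeta>\<close> in \<open>x\<^sup>n = \<zeta> f\<close>. It can be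
  absorbed in \<open>x\<close> if all roots of unity are present, and is removed by raising to the order of the
  torsion group if that group is finite.
\<close>


section \<open>Substituting powers of the variable\<close>

lemma subst_power_mult: "subst_power (P * Q) n = subst_power P n * subst_power Q n"
  by (simp add: subst_power_def pcompose_mult)

lemma subst_power_smult: "subst_power (Polynomial.smult c P) n = Polynomial.smult c (subst_power P n)"
  by (simp add: subst_power_def pcompose_smult)

lemma subst_power_prod_mset:
  "subst_power (prod_mset Qs) n = (\<Prod>Q\<in>#Qs. subst_power Q n)"
  by (induction Qs) (simp_all add: subst_power_mult, simp add: subst_power_def pcompose_1)

lemma degree_subst_power: "Polynomial.degree (subst_power P n) = n * Polynomial.degree P"
  by (simp add: subst_power_def degree_pcompose Polynomial.degree_monom_eq)

lemma subst_power_1: "subst_power P 1 = P"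
  by (simp only: subst_power_def One_nat_def Polynomial.monom_Suc Polynomial.monom_0 pcompose_idR)

lemma subst_power_subst_power: "subst_power (subst_power P n) m = subst_power P (n * m)"
proof -
  have "Polynomial.pcompose (Polynomial.monom (1::'a) n) (Polynomial.monom 1 m)
      = Polynomial.monom 1 m ^ n"
    by (induction n)
      (simp_all add: Polynomial.monom_Suc pcompose_pCons pcompose_1 flip: Polynomial.one_pCons)
  thus ?thesis
    by (simp add: subst_power_def monom_power mult.commute flip: pcompose_assoc)
qed

lemma degree_prod_mset_eq:
  fixes Qs :: "'a::field poly multiset"
  assumes "\<forall>Q\<in>#Qs. Q \<noteq> 0"
  shows "Polynomial.degree (prod_mset Qs) = (\<Sum>Q\<in>#Qs. Polynomial.degree Q)"
  using assms by (induction Qs) (auto simp: Polynomial.degree_mult_eq prod_mset_zero_iff)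


section \<open>Good heredity from a bounded number of factors\<close>

text \<open>
  The degree hypothesis bounds the number of factors by \<open>M deg P\<close>. In a product with as many
  nonconstant factors as possible, among all \<open>n\<close>, no factor can split after a further substitution.
\<close>

lemma good_heredity_if_factor_degrees_large:
  fixes P :: "'a::field poly"
  assumes "P \<noteq> 0"
    and large: "\<And>n Q. n \<ge> 1 \<Longrightarrow> Polynomial.degree Q > 0 \<Longrightarrow> Q dvd subst_power P n
                  \<Longrightarrow> n \<le> M * Polynomial.degree Q"
  shows "poly_good_heredity P"
proof -
  define splits where "splits = (\<lambda>(n, Qs). n \<ge> 1 \<and> (\<forall>Q\<in>#Qs. Polynomial.degree Q > 0) \<and>
    (\<exists>c. c \<noteq> 0 \<and> subst_power P n = Polynomial.smult c (prod_mset Qs)))"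
  have bounded: "size Qs \<le> M * Polynomial.degree P" if "splits (n, Qs)" for n Qs
  proof -
    from that obtain c where n: "n \<ge> 1" and pos: "\<forall>Q\<in>#Qs. Polynomial.degree Q > 0"
      and c: "c \<noteq> 0" "subst_power P n = Polynomial.smult c (prod_mset Qs)"
      by (auto simp: splits_def)
    have "n \<le> M * Polynomial.degree Q" if "Q \<in># Qs" for Q
      using that n pos c by (intro large) (auto intro!: dvd_smult dvd_prod_mset)
    hence "(\<Sum>Q\<in>#Qs. n) \<le> (\<Sum>Q\<in>#Qs. M * Polynomial.degree Q)"
      by (intro sum_mset_mono) auto
    also have "\<dots> = M * Polynomial.degree (prod_mset Qs)"
      using pos by (subst degree_prod_mset_eq) (auto simp: sum_mset_distrib_left)
    also have "Polynomial.degree (prod_mset Qs) = n * Polynomial.degree P"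
      using c by (simp flip: degree_subst_power)
    finally have "n * size Qs \<le> n * (M * Polynomial.degree P)"
      by (simp add: mult_ac)
    thus ?thesis using n by simp
  qed
  have "\<exists>x. splits x"
  proof (cases "Polynomial.degree P = 0")
    case True
    then obtain c where "P = [:c:]" by (auto elim: degree_eq_zeroE)
    thus ?thesis using assms(1) subst_power_1[of P]
      by (intro exI[of _ "(1, {#})"]) (auto simp: splits_def)
  next
    case False
    thus ?thesis using subst_power_1[of P]
      by (intro exI[of _ "(1, {#P#})"]) (auto simp: splits_def intro!: exI[of _ 1])
  qed
  then obtain x where "splits x" ..
  then obtain y where y: "splits y" "\<And>z. splits z \<Longrightarrow> size (snd z) \<le> size (snd y)"
    using ex_has_greatest_nat[of splits x "size \<circ> snd" "Suc (M * Polynomial.degree P)"] bounded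
    by (auto simp: less_Suc_eq_le)
  obtain n Qs where y_eq: "y = (n, Qs)" by fastforce
  obtain c where n: "n \<ge> 1" and pos: "\<forall>Q\<in>#Qs. Polynomial.degree Q > 0"
    and c: "c \<noteq> 0" "subst_power P n = Polynomial.smult c (prod_mset Qs)"
    using y(1) by (auto simp: splits_def y_eq)
  have max: "size Rs \<le> size Qs" if "splits (k, Rs)" for k Rs
    using y(2)[OF that] by (simp add: y_eq)
  have "hereditarily_irreducible Q" if Q: "Q \<in># Qs" for Q
    unfolding hereditarily_irreducible_def
  proof (intro allI impI)
    fix m :: nat assume m: "m \<ge> 1"
    have deg: "Polynomial.degree (subst_power Q m) > 0"
      using pos Q m by (auto simp: degree_subst_power)
    show "Factorial_Ring.irreducible (subst_power Q m)"
    proof (rule Factorial_Ring.irreducibleI)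
      show "subst_power Q m \<noteq> 0" "\<not> is_unit (subst_power Q m)"
        using deg by (auto simp: is_unit_poly_iff)
    next
      fix A B assume AB: "subst_power Q m = A * B"
      show "is_unit A \<or> is_unit B"
      proof (rule ccontr)
        assume not_unit: "\<not> (is_unit A \<or> is_unit B)"
        have "A \<noteq> 0" "B \<noteq> 0" using deg AB by auto
        hence degs: "Polynomial.degree A > 0" "Polynomial.degree B > 0"
          using not_unit by (auto simp: is_unit_iff_degree)
        define Rs where "Rs = image_mset (\<lambda>R. subst_power R m) (Qs - {#Q#})"
        have "prod_mset (add_mset A (add_mset B Rs)) = subst_power (prod_mset (add_mset Q (Qs - {#Q#}))) m"
          by (simp only: subst_power_prod_mset) (simp add: AB Rs_def mult_ac)
        also have "add_mset Q (Qs - {#Q#}) = Qs" using Q by simp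
        finally have "subst_power P (n * m)
            = Polynomial.smult c (prod_mset (add_mset A (add_mset B Rs)))"
          using c by (metis subst_power_subst_power subst_power_smult)
        moreover have "\<forall>R\<in>#Rs. Polynomial.degree R > 0"
          using pos m by (auto simp: Rs_def degree_subst_power dest: in_diffD)
        ultimately have "splits (n * m, add_mset A (add_mset B Rs))"
          using degs n m c by (auto simp: splits_def)
        from max[OF this] show False
          using size_Diff_singleton[OF Q] Q by (simp add: Rs_def)
      qed
    qed
  qed
  thus ?thesis
    unfolding poly_good_heredity_def using n c by blast
qed


section \<open>Good heredity of linear polynomials forces rootlessness\<close>

text \<open>
  A nonconstant divisor of a product of primes has one of the primes as a factor, so it cannot have
  smaller degree than all of them.
\<close>

lemma dvd_prod_of_primes_degree:
  fixes D :: "'a::field poly"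
  assumes "\<forall>Q\<in>#Qs. prime_elem Q \<and> Polynomial.degree Q > Polynomial.degree D"
    and "D dvd prod_mset Qs"
  shows "Polynomial.degree D = 0"
  using assms
proof (induction Qs)
  case empty
  thus ?case by (auto simp: is_unit_poly_iff)
next
  case (add p Qs)
  have p: "prime_elem p" "Polynomial.degree p > Polynomial.degree D" using add.prems by auto
  hence "p \<noteq> 0" by auto
  have nz: "prod_mset (add_mset p Qs) \<noteq> 0"
    using add.prems(1) by (auto simp: prod_mset_zero_iff)
  from add.prems obtain E where E: "p * prod_mset Qs = D * E" by auto
  have "\<not> p dvd D"
  proof
    assume "p dvd D"
    moreover have "D \<noteq> 0" using nz add.prems(2) by (metis dvd_0_left_iff)
    ultimately show False using p(2) dvd_imp_degree_le[of p D] by simp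
  qed
  with p(1) E have "p dvd E"
    using prime_elem_dvd_multD[OF p(1), of D E] by (metis dvd_triv_left)
  then obtain E' where "E = p * E'" ..
  with E have "p * prod_mset Qs = p * (D * E')" by (simp add: mult_ac)
  with \<open>p \<noteq> 0\<close> have "D dvd prod_mset Qs" by auto
  thus ?case using add by auto
qed

text \<open>
  An \<open>N\<close>-th root \<open>b\<close> of \<open>f\<close> yields the factor \<open>x\<^sup>n - b\<close> of \<open>x\<^sup>n\<^sup>N - f\<close>, which for \<open>N > n\<close> has too small
  a degree to be built from the hereditarily irreducible factors \<open>Q(x\<^sup>N)\<close>.
\<close>

lemma rootless_if_linear_good_heredity:
  assumes "linear_good_heredity TYPE('a::field)"
  shows "rootless_field (UNIV :: 'a set)"
  unfolding rootless_field_def rootless_in_def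
proof (intro ballI impI conjI)
  fix f :: 'a assume f: "f \<noteq> 0 \<and> \<not> root_of_unity f"
  show "f \<in> UNIV" "\<not> root_of_unity f" using f by auto
  have "poly_good_heredity [:-f, 1:]"
    using assms f unfolding linear_good_heredity_def by (auto simp: add_eq_0_iff)
  then obtain n c Qs where n: "n \<ge> 1" and c: "c \<noteq> 0"
    and Qs: "\<And>Q. Q \<in># Qs \<Longrightarrow> hereditarily_irreducible Q"
    and eq: "subst_power [:-f, 1:] n = Polynomial.smult c (prod_mset Qs)"
    unfolding poly_good_heredity_def by blast
  have "N \<le> n" if N: "N \<ge> 1" and b: "b ^ N = f" for N and b :: 'a
  proof (rule ccontr)
    assume "\<not> N \<le> n"
    define D where "D = subst_power [:-b, 1:] n"
    define Rs where "Rs = image_mset (\<lambda>Q. subst_power Q N) Qs"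
    have deg_D: "Polynomial.degree D = n" by (simp add: D_def degree_subst_power)
    have "Polynomial.poly (subst_power [:-f, 1:] N) b = 0"
      using b by (simp add: subst_power_def poly_pcompose Polynomial.poly_monom)
    hence "[:-b, 1:] dvd subst_power [:-f, 1:] N" by (simp add: poly_eq_0_iff_dvd)
    hence "D dvd subst_power (subst_power [:-f, 1:] N) n"
      unfolding D_def by (metis dvd_def subst_power_mult)
    also have "\<dots> = subst_power (subst_power [:-f, 1:] n) N"
      by (simp add: subst_power_subst_power mult.commute)
    also have "\<dots> = Polynomial.smult c (prod_mset Rs)"
      by (simp add: eq subst_power_smult subst_power_prod_mset Rs_def)
    finally have "D dvd prod_mset Rs" using c by (simp add: dvd_smult_iff)
    moreover have "prime_elem R \<and> Polynomial.degree R > Polynomial.degree D" if "R \<in># Rs" for R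
    proof -
      from that obtain Q where Q: "Q \<in># Qs" "R = subst_power Q N" by (auto simp: Rs_def)
      have irred: "Factorial_Ring.irreducible R"
        using Qs[OF Q(1)] N Q(2) unfolding hereditarily_irreducible_def by blast
      hence "R \<noteq> 0" "\<not> is_unit R" by (auto simp: Factorial_Ring.irreducible_def)
      hence "Polynomial.degree R > 0" by (simp add: is_unit_iff_degree)
      hence "Polynomial.degree Q > 0" by (simp add: Q(2) degree_subst_power)
      hence "Polynomial.degree R \<ge> N" by (simp add: Q(2) degree_subst_power)
      thus ?thesis
        using field_poly_irreducible_imp_prime[OF irred] \<open>\<not> N \<le> n\<close> deg_D by auto
    qed
    ultimately have "Polynomial.degree D = 0"
      using dvd_prod_of_primes_degree by blast
    thus False using deg_D n by simp
  qed
  hence "{N. N \<ge> 1 \<and> (\<exists>x\<in>UNIV. x ^ N = f)} \<subseteq> {..n}" by auto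
  thus "finite {N. N \<ge> 1 \<and> (\<exists>x\<in>UNIV. x ^ N = f)}"
    using finite_subset by blast
qed


section \<open>Rootless against rootless modtor\<close>

lemma root_of_unity_of_power: "n \<ge> 1 \<Longrightarrow> root_of_unity (z ^ n) \<Longrightarrow> root_of_unity z"
  unfolding root_of_unity_def by (metis power_mult mult_le_mono mult_1)

lemma root_of_unity_to_ac: "root_of_unity (to_ac z) \<longleftrightarrow> root_of_unity z"
  unfolding root_of_unity_def by (metis to_ac_power to_ac_eq_1_iff)

text \<open>
  The \<open>n\<close>-th roots of a root of unity are roots of unity, so they lie in the base field and the factor
  \<open>\<zeta>\<close> in \<open>x\<^sup>n = \<zeta> f\<close> can be divided out.
\<close>

lemma rootless_modtor_if_all_roots_of_unity:
  assumes "rootless_field (UNIV :: 'a::field set)"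
    and all: "\<And>z :: 'a alg_closure. root_of_unity z \<Longrightarrow> z \<in> range to_ac"
  shows "rootless_modtor_field (UNIV :: 'a set)"
  unfolding rootless_modtor_field_def rootless_modtor_in_def
proof (intro ballI impI conjI)
  fix f :: 'a assume f: "f \<noteq> 0 \<and> \<not> root_of_unity f"
  show "f \<in> UNIV" "\<not> root_of_unity f" using f by auto
  have fin: "finite {n. n \<ge> 1 \<and> (\<exists>x\<in>UNIV. x ^ n = f)}"
    using assms(1) f by (simp add: rootless_field_def rootless_in_def)
  have "\<exists>y. y ^ n = f" if n: "n \<ge> 1" and z: "root_of_unity z" and x: "x ^ n = z * f"
    for n and z x :: 'a
  proof -
    obtain w where w: "w ^ n = to_ac z" using nth_root_exists[of n "to_ac z"] n by auto
    hence "root_of_unity w"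
      using root_of_unity_of_power[OF n, of w] z by (simp add: root_of_unity_to_ac)
    then obtain u where "w = to_ac u" using all by blast
    hence u: "u ^ n = z" using w by (metis to_ac_power to_ac_eq_iff)
    have "z \<noteq> 0" using z by (auto simp: root_of_unity_def power_0_left split: if_splits)
    hence "(x / u) ^ n = f" using x u by (simp add: power_divide)
    thus ?thesis ..
  qed
  thus "finite {n. n \<ge> 1 \<and> (\<exists>\<zeta>\<in>UNIV. root_of_unity \<zeta> \<and> (\<exists>x\<in>UNIV. x ^ n = \<zeta> * f))}"
    by (intro finite_subset[OF _ fin]) auto
qed

text \<open>
  Let \<open>w\<close> be a common multiple of the orders of the roots of unity. Every solution of \<open>x\<^sup>n = \<zeta> f\<close> gives
  the \<open>n\<close>-th root \<open>x\<^sup>w\<close> of \<open>f\<^sup>w\<close>, and \<open>f\<^sup>w\<close> is rootless.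
\<close>

lemma rootless_modtor_if_finitely_many_roots_of_unity:
  assumes "rootless_field (UNIV :: 'a::field set)"
    and fin: "finite {z :: 'a. root_of_unity z}"
  shows "rootless_modtor_field (UNIV :: 'a set)"
  unfolding rootless_modtor_field_def rootless_modtor_in_def
proof (intro ballI impI conjI)
  fix f :: 'a assume f: "f \<noteq> 0 \<and> \<not> root_of_unity f"
  show "f \<in> UNIV" "\<not> root_of_unity f" using f by auto
  have "\<forall>z\<in>{z::'a. root_of_unity z}. \<exists>k\<ge>1. z ^ k = 1" by (simp add: root_of_unity_def)
  then obtain k where k: "\<And>z::'a. root_of_unity z \<Longrightarrow> k z \<ge> (1::nat) \<and> z ^ k z = 1"
    using bchoice[of "{z::'a. root_of_unity z}" "\<lambda>z k. k \<ge> 1 \<and> z ^ k = 1"] by auto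
  define w where "w = (\<Prod>z | root_of_unity (z::'a). k z)"
  have w: "w \<ge> 1" unfolding w_def using k
    by (simp only: Suc_le_eq One_nat_def) (auto intro!: prod_pos)
  have z_w: "z ^ w = 1" if "root_of_unity z" for z :: 'a
  proof -
    have "k z dvd w" unfolding w_def using fin that by (intro dvd_prodI) auto
    thus ?thesis using k[OF that] by (metis dvd_def power_mult power_one)
  qed
  have "f ^ w \<noteq> 0 \<and> \<not> root_of_unity (f ^ w)"
    using f w root_of_unity_of_power by auto
  hence "finite {n. n \<ge> 1 \<and> (\<exists>x\<in>UNIV. x ^ n = f ^ w)}"
    using assms(1) by (simp add: rootless_field_def rootless_in_def)
  moreover have "\<exists>y. y ^ n = f ^ w" if "root_of_unity z" "x ^ n = z * f" for n and z x :: 'a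
    using that z_w[of z] by (intro exI[of _ "x ^ w"])
      (metis power_mult_distrib power_mult mult.commute mult_1)
  ultimately show "finite {n. n \<ge> 1 \<and> (\<exists>\<zeta>\<in>UNIV. root_of_unity \<zeta> \<and> (\<exists>x\<in>UNIV. x ^ n = \<zeta> * f))}"
    by (elim rev_finite_subset) auto
qed


section \<open>Polynomials over a subfield\<close>

lemma subfield_closed:
  fixes K :: "'b::field set"
  assumes "subfield K ring_of_type_algebra"
  shows "0 \<in> K" "1 \<in> K"
    and "x \<in> K \<Longrightarrow> y \<in> K \<Longrightarrow> x + y \<in> K"
    and "x \<in> K \<Longrightarrow> y \<in> K \<Longrightarrow> x * y \<in> K"
    and "x \<in> K \<Longrightarrow> - x \<in> K"
    and "x \<in> K \<Longrightarrow> y \<in> K \<Longrightarrow> x - y \<in> K"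
    and "x \<in> K \<Longrightarrow> inverse x \<in> K"
    and "x \<in> K \<Longrightarrow> y \<in> K \<Longrightarrow> x / y \<in> K"
    and "x \<in> K \<Longrightarrow> x ^ n \<in> K"
proof -
  interpret R: field "ring_of_type_algebra :: 'b ring" by (rule field_from_type_algebra)
  have carrier: "\<And>x::'b. x \<in> carrier ring_of_type_algebra"
    by (simp add: ring_of_type_algebra_def)
  note sub = subringE[OF subfieldE(1)[OF assms]]
  show 0: "0 \<in> K" and 1: "1 \<in> K"
    using sub(2,3) by (simp_all add: ring_of_type_algebra_def)
  show add: "\<And>x y. x \<in> K \<Longrightarrow> y \<in> K \<Longrightarrow> x + y \<in> K"
    using sub(7) by (simp add: ring_of_type_algebra_def)
  show mult: "\<And>x y. x \<in> K \<Longrightarrow> y \<in> K \<Longrightarrow> x * y \<in> K"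
    using sub(6) by (simp add: ring_of_type_algebra_def)
  show uminus: "- x \<in> K" if "x \<in> K" for x
  proof -
    have "\<ominus>\<^bsub>ring_of_type_algebra\<^esub> x = - x"
      by (rule R.minus_equality) (auto simp: ring_of_type_algebra_def)
    thus ?thesis using sub(5)[OF that] by simp
  qed
  show "\<And>x y. x \<in> K \<Longrightarrow> y \<in> K \<Longrightarrow> x - y \<in> K"
    using add uminus by (metis add_uminus_conv_diff)
  show inverse: "inverse x \<in> K" if "x \<in> K" for x
  proof (cases "x = 0")
    case False
    have "inv\<^bsub>ring_of_type_algebra\<^esub> x = inverse x"
      using False by (intro R.comm_inv_char) (auto simp: ring_of_type_algebra_def)
    thus ?thesis using R.subfield_m_inv(1)[OF assms, of x] that False
      by (simp add: ring_of_type_algebra_def)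
  qed (simp add: 0)
  show "\<And>x y. x \<in> K \<Longrightarrow> y \<in> K \<Longrightarrow> x / y \<in> K"
    using mult inverse by (metis field_class.field_divide_inverse)
  show "x \<in> K \<Longrightarrow> x ^ n \<in> K" by (induction n) (auto simp: 1 mult)
qed

definition poly_over :: "'b::field set \<Rightarrow> 'b poly \<Rightarrow> bool" where
  "poly_over K p \<longleftrightarrow> (\<forall>i. Polynomial.coeff p i \<in> K)"

text \<open>
  Division by a monic polynomial uses only ring operations on the coefficients, so the remainder
  stays over the subfield.
\<close>

lemma monic_division_over_subfield:
  fixes R S :: "'b::field poly"
  assumes K: "subfield K ring_of_type_algebra"
    and R: "poly_over K R" "Polynomial.lead_coeff R = 1" and S: "poly_over K S"
  shows "\<exists>q r. S = R * q + r \<and> poly_over K r \<and> (r = 0 \<or> Polynomial.degree r < Polynomial.degree R)"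
  using S
proof (induction "Polynomial.degree S" arbitrary: S rule: less_induct)
  case less
  consider "Polynomial.degree R = 0" | "Polynomial.degree S < Polynomial.degree R"
    | "Polynomial.degree R > 0" "Polynomial.degree R \<le> Polynomial.degree S" by linarith
  thus ?case
  proof cases
    case 1
    hence "R = 1" using R(2) by (metis degree_eq_zeroE coeff_pCons_0 pCons_one)
    thus ?thesis
      by (intro exI[of _ S] exI[of _ 0]) (simp add: poly_over_def subfield_closed(1)[OF K])
  next
    case 2
    thus ?thesis using less.prems by (intro exI[of _ 0] exI[of _ S]) simp
  next
    case 3
    define T where "T = Polynomial.monom (Polynomial.lead_coeff S)
      (Polynomial.degree S - Polynomial.degree R)"
    define S' where "S' = S - T * R"
    have coeff: "Polynomial.coeff S' i = Polynomial.coeff S i -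
        (if i < Polynomial.degree S - Polynomial.degree R then 0
         else Polynomial.lead_coeff S * Polynomial.coeff R (i - (Polynomial.degree S - Polynomial.degree R)))"
      for i by (simp add: S'_def T_def coeff_monom_mult)
    have over: "poly_over K S'"
      using less.prems R(1) unfolding poly_over_def coeff
      by (auto intro!: subfield_closed[OF K])
    have "Polynomial.degree S' \<le> Polynomial.degree S"
    proof (rule degree_le, intro allI impI)
      fix i assume "Polynomial.degree S < i"
      thus "Polynomial.coeff S' i = 0"
        using 3 by (auto simp: coeff coeff_eq_0)
    qed
    moreover have "Polynomial.coeff S' (Polynomial.degree S) = 0"
      using 3 R(2) by (simp add: coeff)
    ultimately have "Polynomial.degree S' < Polynomial.degree S"
      using 3 by (metis Polynomial.degree_0 leading_coeff_0_iff order_le_less order_less_le_trans)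
    from less.hyps[OF this over] obtain q r where
      "S' = R * q + r" "poly_over K r" "r = 0 \<or> Polynomial.degree r < Polynomial.degree R"
      by blast
    thus ?thesis
      by (intro exI[of _ "q + T"] exI[of _ r]) (auto simp: S'_def algebra_simps)
  qed
qed

lemma minimal_polynomial_over_subfield:
  fixes S :: "'b::field poly"
  assumes K: "subfield K ring_of_type_algebra"
    and S: "poly_over K S" "S \<noteq> 0" "Polynomial.poly S b = 0"
  obtains R where "poly_over K R" "Polynomial.lead_coeff R = 1" "Polynomial.poly R b = 0"
    "Polynomial.degree R > 0" "\<And>T. poly_over K T \<Longrightarrow> Polynomial.poly T b = 0 \<Longrightarrow> R dvd T"
proof -
  define annih where "annih = (\<lambda>T. poly_over K T \<and> T \<noteq> 0 \<and> Polynomial.poly T b = 0)"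
  obtain T where T: "annih T" "\<And>U. annih U \<Longrightarrow> Polynomial.degree T \<le> Polynomial.degree U"
    using ex_has_least_nat[of annih S Polynomial.degree] S by (auto simp: annih_def)
  define R where "R = Polynomial.smult (inverse (Polynomial.lead_coeff T)) T"
  have "T \<noteq> 0" using T by (simp add: annih_def)
  hence R: "annih R" "Polynomial.lead_coeff R = 1" "Polynomial.degree R = Polynomial.degree T"
    using T(1) by (auto simp: R_def annih_def poly_over_def intro!: subfield_closed[OF K])
  show ?thesis
  proof
    show "poly_over K R" "Polynomial.lead_coeff R = 1" "Polynomial.poly R b = 0"
      using R by (auto simp: annih_def)
    show "Polynomial.degree R > 0"
    proof (rule ccontr)
      assume "\<not> Polynomial.degree R > 0"
      hence "R = 1" using R(2) by (metis degree_eq_zeroE coeff_pCons_0 pCons_one gr0I)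
      thus False using R(1) by (simp add: annih_def)
    qed
    fix U assume U: "poly_over K U" "Polynomial.poly U b = 0"
    obtain q r where qr: "U = R * q + r" "poly_over K r"
      "r = 0 \<or> Polynomial.degree r < Polynomial.degree R"
      using monic_division_over_subfield[OF K _ R(2) U(1)] R(1) by (auto simp: annih_def)
    have "Polynomial.poly r b = 0" using qr(1) U(2) R(1) by (auto simp: annih_def)
    hence "r = 0" using T(2)[of r] qr(2,3) R(3) unfolding annih_def by (metis not_le)
    thus "R dvd U" using qr(1) by simp
  qed
qed


section \<open>Degrees of radicals of rootless elements\<close>

text \<open>
  If \<open>R\<close> is the minimal polynomial over \<open>K\<close> of an \<open>n\<close>-th root \<open>\<beta>\<close> of \<open>a\<close>, the element raised to the power
  \<open>n\<close> here is the norm of \<open>\<beta>\<close> from \<open>K(\<beta>)\<close> to \<open>K\<close>. It is the product of the roots of \<open>R\<close>, each of which is an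
  \<open>n\<close>-th root of \<open>a\<close>.
\<close>

lemma norm_of_radical:
  fixes R :: "'b::alg_closed_field poly"
  assumes "Polynomial.lead_coeff R = 1" "R dvd Polynomial.monom 1 n - [:a:]"
  shows "((-1) ^ Polynomial.degree R * Polynomial.coeff R 0) ^ n = a ^ Polynomial.degree R"
proof -
  have "R \<noteq> 0" using assms(1) by auto
  then obtain A where A: "size A = Polynomial.degree R" "R = (\<Prod>x\<in>#A. [:-x, 1:])"
    using alg_closed_imp_factorization[of R] assms(1) by auto
  have "x ^ n = a" if "x \<in># A" for x
  proof -
    have "[:-x, 1:] dvd R" unfolding A(2) using that by (intro dvd_prod_mset) auto
    hence "[:-x, 1:] dvd Polynomial.monom 1 n - [:a:]" using assms(2) dvd_trans by blast
    thus ?thesis by (simp add: Polynomial.poly_monom flip: poly_eq_0_iff_dvd)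
  qed
  hence "(prod_mset A) ^ n = a ^ size A"
    by (induction A) (auto simp: power_mult_distrib)
  moreover have "Polynomial.coeff R 0 = (-1) ^ size A * prod_mset A"
  proof -
    have "Polynomial.poly (\<Prod>x\<in>#A. [:-x, 1:]) 0 = (-1) ^ size A * prod_mset A"
      by (induction A) auto
    thus ?thesis using A(2) by (simp add: poly_0_coeff_0)
  qed
  hence "(-1) ^ Polynomial.degree R * Polynomial.coeff R 0 = prod_mset A"
    by (simp add: A(1) flip: mult.assoc power_mult_distrib)
  ultimately show ?thesis using A(1) by simp
qed

text \<open>
  With \<open>h = gcd d n\<close>, the relation says that \<open>g\<^bsup>n/h\<^esup>\<close> and \<open>a\<^bsup>d/h\<^esup>\<close> agree up to an \<open>h\<close>-th root of unity.
  Modulo torsion \<open>a\<^bsup>d/h\<^esup>\<close> is thus a power with exponent \<open>n/h\<close>, and so is \<open>a\<close> itself because \<open>d/h\<close> is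
  invertible modulo \<open>n/h\<close>.
\<close>

lemma power_modulo_torsion_if_power_eq:
  fixes a g :: "'b::field"
  assumes K: "subfield K ring_of_type_algebra" and "a \<in> K" "g \<in> K" "a \<noteq> 0"
    and d: "d \<ge> 1" and eq: "g ^ n = a ^ d"
  shows "\<exists>\<zeta>\<in>K. root_of_unity \<zeta> \<and> (\<exists>x\<in>K. x ^ (n div gcd d n) = \<zeta> * a)"
proof -
  define h where "h = gcd d n"
  have h: "h \<ge> 1" "n div h * h = n" using d by (simp_all add: h_def Suc_le_eq)
  obtain u v where uv: "d * u = n * v + h"
    using bezout_nat[of d n] d by (auto simp: h_def)
  \<comment> \<open>Since \<open>g\<^sup>n = a\<^sup>d\<close>, the choice of \<open>u\<close> and \<open>v\<close> makes \<open>x\<^sup>n\<close> equal to \<open>a\<^sup>h\<close>.\<close>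
  define x where "x = g ^ u / a ^ v"
  define \<zeta> where "\<zeta> = x ^ (n div h) / a"
  have "(g ^ u) ^ n = (g ^ n) ^ u" by (metis power_mult mult.commute)
  also have "\<dots> = a ^ (n * v + h)" by (simp add: eq uv flip: power_mult)
  finally have "x ^ n = a ^ h"
    using \<open>a \<noteq> 0\<close> by (simp add: x_def power_divide power_add mult.commute flip: power_mult)
  hence "\<zeta> ^ h = 1"
    using \<open>a \<noteq> 0\<close> h(2) by (simp add: \<zeta>_def power_divide flip: power_mult)
  hence "root_of_unity \<zeta>" using h(1) by (auto simp: root_of_unity_def)
  moreover have "x \<in> K" "\<zeta> \<in> K"
    unfolding x_def \<zeta>_def using assms(2,3) by (auto intro!: subfield_closed[OF K])
  moreover have "x ^ (n div h) = \<zeta> * a" using \<open>a \<noteq> 0\<close> by (simp add: \<zeta>_def)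
  ultimately show ?thesis unfolding h_def by blast
qed

text \<open>
  The degree \<open>d\<close> of \<open>b\<close> over \<open>K\<close> is at least \<open>gcd d n\<close>, and the norm of \<open>b\<close> shows that \<open>n / gcd d n\<close> is one
  of the exponents bounded by \<open>M\<close>.
\<close>

lemma exponent_le_degree_of_radical:
  fixes b :: "'b::alg_closed_field"
  assumes K: "subfield K ring_of_type_algebra" and a: "b ^ n = a" "a \<in> K" "a \<noteq> 0" and n: "n \<ge> 1"
    and M: "\<And>m. m \<ge> 1 \<Longrightarrow> \<exists>\<zeta>\<in>K. root_of_unity \<zeta> \<and> (\<exists>x\<in>K. x ^ m = \<zeta> * a) \<Longrightarrow> m \<le> M"
    and S: "poly_over K S" "S \<noteq> 0" "Polynomial.poly S b = 0"
  shows "n \<le> M * Polynomial.degree S"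
proof -
  obtain R where R: "poly_over K R" "Polynomial.lead_coeff R = 1" "Polynomial.poly R b = 0"
    "Polynomial.degree R > 0" "\<And>T. poly_over K T \<Longrightarrow> Polynomial.poly T b = 0 \<Longrightarrow> R dvd T"
    using minimal_polynomial_over_subfield[OF K S] by blast
  define d where "d = Polynomial.degree R"
  define g where "g = (-1) ^ d * Polynomial.coeff R 0"
  have "poly_over K (Polynomial.monom 1 n - [:a:])"
    unfolding poly_over_def using a
    by (auto simp: coeff_pCons intro!: subfield_closed[OF K] split: nat.splits)
  moreover have "Polynomial.poly (Polynomial.monom 1 n - [:a:]) b = 0"
    using a by (simp add: Polynomial.poly_monom)
  ultimately have "R dvd Polynomial.monom 1 n - [:a:]" by (rule R(5))
  hence "g ^ n = a ^ d" unfolding g_def d_def using R(2) by (intro norm_of_radical) auto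
  moreover have "g \<in> K"
    using R(1) unfolding g_def poly_over_def by (auto intro!: subfield_closed[OF K])
  ultimately have "\<exists>\<zeta>\<in>K. root_of_unity \<zeta> \<and> (\<exists>x\<in>K. x ^ (n div gcd d n) = \<zeta> * a)"
    using a R(4) by (intro power_modulo_torsion_if_power_eq[OF K, of a g]) (auto simp: d_def)
  moreover have "n div gcd d n \<ge> 1"
    using n by (simp add: Suc_le_eq div_greater_zero_iff gcd_le2_nat)
  ultimately have "n div gcd d n \<le> M" using M by blast
  moreover have "gcd d n \<le> d" using R(4) by (simp add: d_def gcd_le1_nat)
  ultimately have "n \<le> M * d"
    using mult_le_mono[of "n div gcd d n" M "gcd d n" d] by simp
  also have "d \<le> Polynomial.degree S"
    unfolding d_def using R(5)[OF S(1,3)] S(2) by (rule dvd_imp_degree_le)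
  finally show ?thesis by simp
qed


section \<open>Rootless modtor roots give good heredity\<close>

lemma map_poly_to_ac_mult: "map_poly to_ac (P * Q) = map_poly to_ac P * map_poly to_ac Q"
  by (rule poly_eqI) (simp add: coeff_map_poly Polynomial.coeff_mult to_ac_sum)

lemma poly_map_poly_to_ac_subst_power:
  "Polynomial.poly (map_poly to_ac (subst_power P n)) z = Polynomial.poly (map_poly to_ac P) (z ^ n)"
proof (induction P)
  case (pCons a P)
  have "map_poly to_ac (subst_power (pCons a P) n)
      = [:to_ac a:] + Polynomial.monom 1 n * map_poly to_ac (subst_power P n)"
    by (rule poly_eqI)
      (simp add: subst_power_def pcompose_pCons coeff_map_poly coeff_monom_mult coeff_pCons
            split: nat.splits)
  thus ?case using pCons by (simp add: map_poly_pCons Polynomial.poly_monom)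
qed (simp add: subst_power_def)

lemma subfield_range_to_ac: "subfield (range (to_ac :: 'a::field \<Rightarrow> _)) ring_of_type_algebra"
proof -
  interpret R: field "ring_of_type_algebra :: 'a alg_closure ring" by (rule field_from_type_algebra)
  have minus: "\<ominus>\<^bsub>ring_of_type_algebra\<^esub> x = - x" for x :: "'a alg_closure"
    by (rule R.minus_equality) (auto simp: ring_of_type_algebra_def)
  have inverse: "inv\<^bsub>ring_of_type_algebra\<^esub> x = inverse x" if "x \<noteq> 0" for x :: "'a alg_closure"
    using that by (intro R.comm_inv_char) (auto simp: ring_of_type_algebra_def)
  have one_in_range: "\<one>\<^bsub>ring_of_type_algebra\<^esub> \<in> range (to_ac :: 'a \<Rightarrow> _)"
    using rangeI[of to_ac "1::'a"] by (simp add: ring_of_type_algebra_def)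
  show ?thesis
  proof (rule R.subfieldI')
    show "subring (range (to_ac :: 'a \<Rightarrow> _)) ring_of_type_algebra"
    proof (rule R.subringI)
      show "\<one>\<^bsub>ring_of_type_algebra\<^esub> \<in> range (to_ac :: 'a \<Rightarrow> _)" by (fact one_in_range)
      show "\<ominus>\<^bsub>ring_of_type_algebra\<^esub> x \<in> range to_ac" if "x \<in> range to_ac" for x :: "'a alg_closure"
        using that by (auto simp: minus simp flip: to_ac_minus)
    qed (auto simp: ring_of_type_algebra_def simp flip: to_ac_mult to_ac_add)
    fix k :: "'a alg_closure" assume "k \<in> range to_ac - {\<zero>\<^bsub>ring_of_type_algebra\<^esub>}"
    hence "k \<in> range to_ac" "k \<noteq> 0" by (auto simp: ring_of_type_algebra_def)
    thus "inv\<^bsub>ring_of_type_algebra\<^esub> k \<in> range to_ac"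
      by (auto simp: inverse simp flip: to_ac_inverse)
  qed
qed

text \<open>
  The root of a nonconstant factor of \<open>P(x\<^sup>n)\<close> is an \<open>n\<close>-th root of some root \<open>z\<close> of \<open>P\<close>, so its degree is
  bounded below through the field \<open>K\<close> of that \<open>z\<close>. Letting \<open>K\<close> vary with \<open>z\<close> covers both linear polynomials,
  with the base field as \<open>K\<close>, and arbitrary ones, with a finite extension for each root.
\<close>

theorem good_heredity_if_roots_rootless_modtor:
  fixes P :: "'a::field poly"
  assumes "P \<noteq> 0"
    and roots: "\<And>z. Polynomial.poly (map_poly to_ac P) z = 0 \<Longrightarrow> z \<noteq> 0 \<and>
      (\<exists>K. subfield K ring_of_type_algebra \<and> range to_ac \<subseteq> K \<and> rootless_modtor_in K z)"
  shows "poly_good_heredity P"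
proof -
  define Z where "Z = {z. Polynomial.poly (map_poly to_ac P) z = 0}"
  have "map_poly to_ac P \<noteq> 0" using assms(1) by (simp add: map_poly_eq_0_iff)
  hence "finite Z" unfolding Z_def by (rule poly_roots_finite)
  have "\<forall>z\<in>Z. \<exists>K. subfield K ring_of_type_algebra \<and> range to_ac \<subseteq> K \<and> rootless_modtor_in K z"
    using roots by (simp add: Z_def)
  then obtain K where K: "\<And>z. z \<in> Z \<Longrightarrow> subfield (K z) ring_of_type_algebra \<and>
      range to_ac \<subseteq> K z \<and> rootless_modtor_in (K z) z"
    by (auto dest!: bchoice)
  define E where "E = (\<lambda>z. {m. m \<ge> (1::nat) \<and>
    (\<exists>\<zeta>\<in>K z. root_of_unity \<zeta> \<and> (\<exists>x\<in>K z. x ^ m = \<zeta> * z))})"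
  have "finite (\<Union>z\<in>Z. E z)"
    using \<open>finite Z\<close> K by (auto simp: E_def rootless_modtor_in_def)
  then obtain M where M: "\<And>z m. z \<in> Z \<Longrightarrow> m \<in> E z \<Longrightarrow> m \<le> M"
    unfolding finite_nat_set_iff_bounded_le by blast
  show ?thesis
  proof (rule good_heredity_if_factor_degrees_large[OF assms(1)])
    fix n :: nat and Q assume n: "n \<ge> 1" and Q: "Polynomial.degree Q > 0" "Q dvd subst_power P n"
    have deg: "Polynomial.degree (map_poly to_ac Q) = Polynomial.degree Q"
      by (rule map_poly_degree_eq) (use Q(1) in auto)
    then obtain b where b: "Polynomial.poly (map_poly to_ac Q) b = 0"
      using alg_closed_imp_poly_has_root[of "map_poly to_ac Q"] Q(1) by auto
    hence "Polynomial.poly (map_poly to_ac (subst_power P n)) b = 0"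
      using Q(2) by (auto simp: map_poly_to_ac_mult)
    hence Z: "b ^ n \<in> Z" by (simp add: Z_def poly_map_poly_to_ac_subst_power)
    have "n \<le> M * Polynomial.degree (map_poly to_ac Q)"
    proof (rule exponent_le_degree_of_radical[OF _ refl _ _ n _ _ _ b])
      show "subfield (K (b ^ n)) ring_of_type_algebra" "b ^ n \<in> K (b ^ n)"
        using K[OF Z] by (auto simp: rootless_modtor_in_def)
      show "b ^ n \<noteq> 0" using roots[of "b ^ n"] Z unfolding Z_def by blast
      show "poly_over (K (b ^ n)) (map_poly to_ac Q)"
        using K[OF Z] by (auto simp: poly_over_def coeff_map_poly)
      show "map_poly to_ac Q \<noteq> 0" using deg Q(1) by auto
    qed (use M[OF Z] in \<open>auto simp: E_def\<close>)
    thus "n \<le> M * Polynomial.degree Q" by (simp add: deg)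
  qed
qed

lemma linear_good_heredity_if_rootless_modtor:
  assumes "rootless_modtor_field (UNIV :: 'a::field set)"
  shows "linear_good_heredity TYPE('a)"
  unfolding linear_good_heredity_def
proof (intro allI impI)
  fix P :: "'a poly"
  assume P: "Polynomial.degree P = 1 \<and>
    (\<forall>z. Polynomial.poly P z = 0 \<longrightarrow> z \<noteq> 0 \<and> \<not> root_of_unity z)"
  obtain c0 Q where Q: "P = pCons c0 Q" by (rule pCons_cases)
  with P have "Q \<noteq> 0" "Polynomial.degree Q = 0" by (auto split: if_splits)
  with Q obtain c1 where P_eq: "P = [:c0, c1:]" "c1 \<noteq> 0" by (auto elim: degree_eq_zeroE)
  define a where "a = - c0 / c1"
  have "Polynomial.poly P a = 0" using P_eq by (simp add: a_def)
  hence a: "a \<noteq> 0" "\<not> root_of_unity a" using P by auto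
  have "rootless_modtor_in UNIV a"
    using assms a by (simp add: rootless_modtor_field_def)
  hence fin: "finite {m. m \<ge> 1 \<and> (\<exists>\<zeta>. root_of_unity \<zeta> \<and> (\<exists>x. x ^ m = \<zeta> * a))}"
    by (simp add: rootless_modtor_in_def)
  have modtor: "rootless_modtor_in (range to_ac) (to_ac a)"
    using a fin by (simp add: rootless_modtor_in_def root_of_unity_to_ac
      flip: to_ac_mult to_ac_power)
  show "poly_good_heredity P"
  proof (rule good_heredity_if_roots_rootless_modtor)
    show "P \<noteq> 0" using P_eq by simp
    fix z assume "Polynomial.poly (map_poly to_ac P) z = 0"
    hence "to_ac c0 + z * to_ac c1 = 0" using P_eq by (simp add: map_poly_pCons)
    hence "z = to_ac a" using P_eq(2) by (simp add: a_def field_simps add_eq_0_iff)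
    thus "z \<noteq> 0 \<and> (\<exists>K. subfield K ring_of_type_algebra \<and> range to_ac \<subseteq> K \<and>
        rootless_modtor_in K z)"
      using a modtor subfield_range_to_ac by auto
  qed
qed

lemma algebraic_over_range_to_ac:
  fixes x :: "'a::field alg_closure"
  shows "(ring.algebraic ring_of_type_algebra over range to_ac) x"
proof -
  interpret R: field "ring_of_type_algebra :: 'a alg_closure ring" by (rule field_from_type_algebra)
  obtain p :: "'a poly" where p: "p \<noteq> 0" "Polynomial.poly (map_poly to_ac p) x = 0"
    by (rule alg_closure_algebraic)
  \<comment> \<open>An element of the ring \<open>K[X]\<close> lists its coefficients from the leading one down.\<close>
  define q where "q = rev (Polynomial.coeffs (map_poly to_ac p))"
  have nz: "map_poly to_ac p \<noteq> 0" using p(1) by (simp add: map_poly_eq_0_iff)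
  have pow: "y [^]\<^bsub>ring_of_type_algebra\<^esub> n = y ^ n" for y :: "'a alg_closure" and n :: nat
    by (induction n) (auto simp: R.nat_pow_0 R.nat_pow_Suc ring_of_type_algebra_def)
  have eval: "R.eval (rev cs) x = Polynomial.poly (Poly cs) x" for cs
  proof (induction cs rule: rev_induct)
    case (snoc c cs)
    thus ?case by (simp add: Poly_append Polynomial.poly_monom pow)
        (simp add: ring_of_type_algebra_def mult_ac)
  next
    case Nil
    show ?case by simp (simp add: ring_of_type_algebra_def)
  qed
  show ?thesis
  proof (rule R.algebraicI)
    show "q \<noteq> []" using nz by (simp add: q_def)
    show "q \<in> carrier ((range to_ac)[X]\<^bsub>ring_of_type_algebra\<^esub>)"
    proof -
      have "hd q \<noteq> 0" using nz by (simp add: q_def hd_rev last_coeffs_eq_coeff_degree)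
      moreover have "set q \<subseteq> range to_ac"
        by (auto simp: q_def coeffs_map_poly coeffs_def coeff_map_poly)
      ultimately show ?thesis
        by (auto simp: univ_poly_def polynomial_def ring_of_type_algebra_def)
    qed
    show "R.eval q x = \<zero>\<^bsub>ring_of_type_algebra\<^esub>"
      unfolding q_def eval using p(2) by (simp add: ring_of_type_algebra_def)
  qed
qed

lemma finite_extension_containing:
  fixes z :: "'a::field alg_closure"
  obtains K where "finite_extension K" "z \<in> K"
proof -
  interpret R: field "ring_of_type_algebra :: 'a alg_closure ring" by (rule field_from_type_algebra)
  have carrier: "carrier ring_of_type_algebra = (UNIV :: 'a alg_closure set)"
    by (simp add: ring_of_type_algebra_def)
  note F = subfield_range_to_ac
  have "finite_extension (R.simple_extension (range to_ac) z)"
    unfolding finite_extension_def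
    using R.simple_extension_is_subfield[OF F, of z] R.finite_dimension_simple_extension[OF F, of z]
      R.simple_extension_incl[of "range to_ac" z] algebraic_over_range_to_ac[of z]
    by (simp add: carrier)
  moreover have "z \<in> R.simple_extension (range to_ac) z"
    using R.simple_extension_mem[OF subfieldE(1)[OF F]] by (simp add: carrier)
  ultimately show ?thesis by (rule that)
qed

lemma good_heredity_if_finite_extensions_rootless_modtor:
  assumes "\<And>K :: 'a::field alg_closure set. finite_extension K \<Longrightarrow> rootless_modtor_field K"
  shows "field_good_heredity TYPE('a)"
  unfolding field_good_heredity_def
proof (intro allI impI)
  fix P :: "'a poly"
  assume P: "\<forall>z. Polynomial.poly (map_poly to_ac P) z = 0 \<longrightarrow> z \<noteq> 0 \<and> \<not> root_of_unity z"
  show "poly_good_heredity P"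
  proof (rule good_heredity_if_roots_rootless_modtor)
    show "P \<noteq> 0" using P[rule_format, of 0] by auto
    fix z assume "Polynomial.poly (map_poly to_ac P) z = 0"
    hence z: "z \<noteq> 0" "\<not> root_of_unity z" using P by auto
    obtain K where K: "finite_extension K" "z \<in> K" by (rule finite_extension_containing)
    hence "rootless_modtor_in K z"
      using assms[OF K(1)] z by (simp add: rootless_modtor_field_def)
    thus "z \<noteq> 0 \<and> (\<exists>K. subfield K ring_of_type_algebra \<and> range to_ac \<subseteq> K \<and>
        rootless_modtor_in K z)"
      using z(1) K(1) unfolding finite_extension_def by blast
  qed
qed

theorem proposition27:
  shows "((rootless_modtor_field (UNIV :: 'a::field set) \<longrightarrow> linear_good_heredity TYPE('a)) \<and>
      (linear_good_heredity TYPE('a) \<longrightarrow> rootless_field (UNIV :: 'a set))) \<and>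
    ((\<forall>z :: 'a alg_closure. root_of_unity z \<longrightarrow> z \<in> range to_ac) \<or>
       finite {z :: 'a. root_of_unity z} \<longrightarrow>
      (rootless_modtor_field (UNIV :: 'a set) \<longleftrightarrow> linear_good_heredity TYPE('a)) \<and>
      (linear_good_heredity TYPE('a) \<longleftrightarrow> rootless_field (UNIV :: 'a set))) \<and>
    ((\<forall>K :: 'a alg_closure set. finite_extension K \<longrightarrow> rootless_modtor_field K) \<longrightarrow>
      field_good_heredity TYPE('a))"
  using linear_good_heredity_if_rootless_modtor[where 'a = 'a]
    rootless_if_linear_good_heredity[where 'a = 'a]
    rootless_modtor_if_all_roots_of_unity[where 'a = 'a]
    rootless_modtor_if_finitely_many_roots_of_unity[where 'a = 'a]
    good_heredity_if_finite_extensions_rootless_modtor[where 'a = 'a]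
  by blast

end
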